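(* Let $\ell\ge0$ be an integer and let $r_1,\dots,r_k$ be positive integers such that $3+2\ell=\sum_{h=1}^k r_h$, $r_h\le\ell+1$ for every $h=1,\dots,k$, and $k\ge3$. Put $d=\ell+1$. Then $$\sum_{I\sqcup J=\{1,\dots,k\}}(-1)^{\#J}\int_{\mathrm{Gr}(2,d+1-\#J)}\left(\prod_{h\in I}\sigma_{r_h-1}\prod_{h\in J}\sigma_{r_h-2}\right)\cdot\left(\sum_{i+j=k-3-\#J}\sigma_i\sigma_j\right)=1,$$ where the outer sum is over ordered pairs $(I,J)$ of disjoint (possibly empty) subsets with union $\{1,\dots,k\}$ and the inner sum is over ordered pairs $(i,j)$ of non-negative integers.
   Context: $\mathrm{Gr}(2,N)$ is the Grassmannian of $2$-dimensional subspaces of an $N$-dimensional complex vector space, with universal rank 2 subbundle $\mathcal{V}$, and $\sigma_i=s_i(\mathcal{V})\in A^i(\mathrm{Gr}(2,N))$ is the $i$-th Segre class (total Segre class inverse to the total Chern class of $\mathcal{V}$; equivalently $\sigma_i=c_i$ of the universal quotient bundle), so $\sigma_0=1$ and $\sigma_i=0$ if $i<0$ or $i>N-2$. The integral over $\mathrm{Gr}(2,d+1-\#J)$ is interpreted as $0$ unless $d-\#J>0$ and $k-3-\#J\ge0$. *)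

theory Defs
  imports Complex_Main "HOL-Library.Function_Algebras" "HOL-Algebra.Ring"
begin

section \<open>The Grassmannian of 2-planes\<close>

text \<open>
  The dimension N varies inside the statement, so the N-dimensional complex vector space is
  the space of complex sequences supported on the indices below N.
\<close>

global_interpretation cvec: vector_space "\<lambda>(c::complex) (x::nat \<Rightarrow> complex) i. c * x i"
  defines cspan = cvec.span and csubspace = cvec.subspace and cdim = cvec.dim
  by standard (auto simp: fun_eq_iff algebra_simps)

type_synonym cvecs = "(nat \<Rightarrow> complex) set"

definition cspace :: "nat \<Rightarrow> cvecs" where
  "cspace N = {x. \<forall>i\<ge>N. x i = 0}"

definition Gr2 :: "nat \<Rightarrow> cvecs set" where
  "Gr2 N = {V. csubspace V \<and> V \<subseteq> cspace N \<and> cdim V = 2}"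

text \<open>The 2-planes that meet a given linear subspace F nontrivially.\<close>

definition special_schubert :: "nat \<Rightarrow> cvecs \<Rightarrow> cvecs set" where
  "special_schubert N F = {V \<in> Gr2 N. V \<inter> F \<noteq> {0}}"


section \<open>Intersection rings of the Grassmannian\<close>

text \<open>
  HOL has no Chow groups.  The Chow ring of Gr(2,N) therefore enters as an arbitrary
  commutative graded ring that carries the following data and satisfies the axioms of the
  locale below; a theorem about all such rings applies to the Chow ring.

  \<^item> \<open>grade R i\<close>: the group of classes of codimension i;
  \<^item> \<open>cyc R Z\<close>: the class of a closed subvariety Z (its values at other sets are irrelevant);
  \<^item> \<open>chern_sub R i\<close>, \<open>chern_quot R i\<close>: the i-th Chern classes of the universal subbundle (of
    rank 2) and of the universal quotient bundle (of rank N - 2);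
  \<^item> \<open>gr_integral R\<close>: the degree map, that is, integration over Gr(2,N).
\<close>

record 'a intersection_ring = "'a ring" +
  grade :: "nat \<Rightarrow> 'a set"
  cyc :: "cvecs set \<Rightarrow> 'a"
  chern_sub :: "nat \<Rightarrow> 'a"
  chern_quot :: "nat \<Rightarrow> 'a"
  gr_integral :: "'a \<Rightarrow> int"

text \<open>
  \<open>whitney\<close> is the degree n part of c(V) c(Q) = 1, which comes from the exact sequence
  0 \<rightarrow> V \<rightarrow> trivial bundle \<rightarrow> Q \<rightarrow> 0.

  \<open>degeneracy\<close>: N - 1 - i linearly independent vectors give sections of Q, and these become
  linearly dependent exactly at the 2-planes that meet their span F; this locus has the expected
  codimension i, so its class is the i-th Chern class of Q.

  \<open>transverse\<close>: the loci of 2-planes through two different points of projective (N-1)-space meet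
  transversally.  Together with \<open>integral_point\<close> this normalizes the integral.

  All axioms are standard facts about the Chow ring of Gr(2,N), and they determine the
  integral of every polynomial in the Segre classes of the universal subbundle.  No relation
  among the Segre classes and no value of an integral is assumed beyond these.
\<close>

locale Gr2_intersection_ring = cring R
  for N :: nat and R :: "('a, 'b) intersection_ring_scheme" (structure) +
  assumes grade_subgroup: "subgroup (grade R i) (add_monoid R)"
    and one_grade: "\<one> \<in> grade R 0"
    and mult_grade: "\<lbrakk>x \<in> grade R i; y \<in> grade R j\<rbrakk> \<Longrightarrow> x \<otimes> y \<in> grade R (i + j)"
    and chern_sub_grade: "chern_sub R i \<in> grade R i"
    and chern_sub_0: "chern_sub R 0 = \<one>"
    and rank_sub: "i > 2 \<Longrightarrow> chern_sub R i = \<zero>"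
    and chern_quot_grade: "chern_quot R i \<in> grade R i"
    and chern_quot_0: "chern_quot R 0 = \<one>"
    and rank_quot: "i > N - 2 \<Longrightarrow> chern_quot R i = \<zero>"
    and whitney: "n > 0 \<Longrightarrow> (\<Oplus>i\<in>{..n}. chern_sub R i \<otimes> chern_quot R (n - i)) = \<zero>"
    and cyc_closed: "cyc R Z \<in> carrier R"
    and degeneracy: "\<lbrakk>i \<le> N - 2; csubspace F; F \<subseteq> cspace N; cdim F = N - 1 - i\<rbrakk>
          \<Longrightarrow> cyc R (special_schubert N F) = chern_quot R i"
    and transverse: "\<lbrakk>csubspace F; F \<subseteq> cspace N; cdim F = 1;
            csubspace F'; F' \<subseteq> cspace N; cdim F' = 1; F \<noteq> F'\<rbrakk>
          \<Longrightarrow> cyc R (special_schubert N F) \<otimes> cyc R (special_schubert N F')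
              = cyc R (special_schubert N F \<inter> special_schubert N F')"
    and integral_add: "\<lbrakk>x \<in> carrier R; y \<in> carrier R\<rbrakk>
          \<Longrightarrow> gr_integral R (x \<oplus> y) = gr_integral R x + gr_integral R y"
    and integral_grade: "\<lbrakk>x \<in> grade R i; i \<noteq> 2 * (N - 2)\<rbrakk> \<Longrightarrow> gr_integral R x = 0"
    and integral_point: "V \<in> Gr2 N \<Longrightarrow> gr_integral R (cyc R {V}) = 1"


section \<open>Segre classes\<close>

text \<open>
  The Segre classes of the universal subbundle V are the homogeneous parts of 1 / c(V):
  the equations say that c(V) times the total Segre class is 1, where c(V) has only the
  terms of degree 0, 1 and 2.
\<close>

fun segre :: "('a, 'b) intersection_ring_scheme \<Rightarrow> nat \<Rightarrow> 'a" where
  "segre R 0 = \<one>\<^bsub>R\<^esub>"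
| "segre R (Suc 0) = \<ominus>\<^bsub>R\<^esub> chern_sub R 1"
| "segre R (Suc (Suc n)) = \<ominus>\<^bsub>R\<^esub> (chern_sub R 1 \<otimes>\<^bsub>R\<^esub> segre R (Suc n) \<oplus>\<^bsub>R\<^esub> chern_sub R 2 \<otimes>\<^bsub>R\<^esub> segre R n)"

definition \<sigma> :: "('a, 'b) intersection_ring_scheme \<Rightarrow> int \<Rightarrow> 'a" where
  "\<sigma> R i = (if i < 0 then \<zero>\<^bsub>R\<^esub> else segre R (nat i))"

end

(*
  Let x, y be the Chern roots of the dual of the universal subbundle, so that sigma_i becomes the
  complete homogeneous polynomial h_i(x, y).  The integral over Gr(2,N) of a symmetric polynomial f
  of degree 2(N-2) is the coefficient of x^(N-2) y^(N-1) in (y - x) f; after setting x = 1 it is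
  the coefficient of y^(N-1) in (y - 1) f.  Multiplying by y^#J moves all integrals into the
  coefficient of y^d, and the alternating sum becomes the coefficient of y^d t^(k-3) in
    (y - 1) prod_h (h_{r_h - 1} - y t h_{r_h - 2}) / ((1 - t)^2 (1 - y t)^2).
  With u = 1 - t and v = 1 - y t one has (1 - y) (h_{r-1} - y t h_{r-2}) = v - y^r u.  Expand the
  product over the set S of factors contributing - y^r u.  If 2 <= #S <= k - 2 the denominator
  cancels and the degree in t is at most k - 4; if #S >= k - 1 the power of y exceeds d.  The terms
  with #S <= 1 give (1 - y)^(k-3) (k - 2 - sum_h y^(r_h)), whence the value
  - (k - 2) (d + 1) + sum_h (d + 1 - r_h) = 1.
*)
theory Submission
  imports Defs "HOL-Computational_Algebra.Formal_Power_Series"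
begin

section \<open>The generating function\<close>

definition fps_geom :: "'a::comm_ring_1 \<Rightarrow> 'a fps" where
  "fps_geom c = Abs_fps (\<lambda>n. c ^ n)"

lemma fps_nth_geom [simp]: "fps_nth (fps_geom c) n = c ^ n"
  by (simp add: fps_geom_def)

lemma fps_nth_linear_mult:
  fixes f :: "'a::comm_ring_1 fps"
  shows "fps_nth ((1 - fps_const c * fps_X) * f) n = fps_nth f n - (if n = 0 then 0 else c * fps_nth f (n - 1))"
  by (simp add: left_diff_distrib mult.assoc)

text \<open>The coefficients lie in an arbitrary commutative ring, later the integers or
  \<open>int fps\<close>, so this relation takes the place of dividing by
  \<open>1 - fps_const c * fps_X\<close>.\<close>

lemma linear_mult_fps_geom:
  fixes c :: "'a::comm_ring_1"
  shows "(1 - fps_const c * fps_X) * fps_geom c = 1"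
proof (rule fps_ext)
  fix n
  show "fps_nth ((1 - fps_const c * fps_X) * fps_geom c) n = fps_nth 1 n"
    unfolding fps_nth_linear_mult by (cases n) auto
qed

lemma fps_nth_linear_power_eq_0:
  fixes c :: "'a::comm_ring_1"
  shows "n > m \<Longrightarrow> fps_nth ((1 - fps_const c * fps_X) ^ m) n = 0"
  by (induction m arbitrary: n) (auto simp: fps_nth_linear_mult)

lemma fps_nth_mult_eq_0:
  fixes f g :: "'a::comm_ring_1 fps"
  assumes "\<And>n. n > a \<Longrightarrow> fps_nth f n = 0" "\<And>n. n > b \<Longrightarrow> fps_nth g n = 0" "n > a + b"
  shows "fps_nth (f * g) n = 0"
  unfolding fps_mult_nth
proof (rule sum.neutral, rule ballI)
  fix i assume "i \<in> {0..n}"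
  then show "fps_nth f i * fps_nth g (n - i) = 0"
    using assms by (cases "i > a") auto
qed

text \<open>Write 1 - c X as (1 - c) + c (1 - X) and divide by 1 - X.\<close>

lemma linear_mult_fps_geom_1:
  fixes c :: "'a::comm_ring_1"
  shows "(1 - fps_const c * fps_X) * fps_geom 1 = fps_const (1 - c) * fps_geom 1 + fps_const c"
proof -
  have "(1 - fps_const c * fps_X) = fps_const (1 - c) + fps_const c * (1 - fps_const 1 * fps_X)"
    by (simp add: algebra_simps flip: fps_const_sub)
  then show ?thesis
    using linear_mult_fps_geom[of "1::'a"] by (simp only: distrib_right mult.assoc) simp
qed

text \<open>Dividing a polynomial by 1 - X turns its coefficients into partial sums; from its degree
  on these equal the value at X = 1.\<close>

lemma fps_nth_linear_power_geom:
  fixes c :: "'a::comm_ring_1"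
  shows "n \<ge> m \<Longrightarrow> fps_nth ((1 - fps_const c * fps_X) ^ m * fps_geom 1) n = (1 - c) ^ m"
proof (induction m)
  case (Suc m)
  define v where "v = 1 - fps_const c * fps_X"
  define U where "U = (fps_geom 1 :: 'a fps)"
  have vU: "v * U = fps_const (1 - c) * U + fps_const c"
    unfolding v_def U_def by (rule linear_mult_fps_geom_1)
  have "v ^ Suc m * U = v ^ m * (v * U)"
    by simp
  also have "\<dots> = fps_const (1 - c) * (v ^ m * U) + fps_const c * v ^ m"
    unfolding vU by (simp only: distrib_left ac_simps)
  finally show ?case
    using Suc fps_nth_linear_power_eq_0[of m n c] by (simp flip: v_def U_def)
qed auto

text \<open>For p = (1 - c X)^m the coefficient is the sum of (n + 1 - i) p_i, that is (n + 1) p(1)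
  - p'(1). The weight of p_(n+1) is 0, so m = n + 1 is still allowed; \<open>genfun_term_0\<close>
  uses this borderline case.\<close>

lemma fps_nth_linear_power_geom_square:
  fixes c :: "'a::comm_ring_1"
  shows "n + 1 \<ge> m \<Longrightarrow> fps_nth ((1 - fps_const c * fps_X) ^ m * fps_geom 1 ^ 2) n
    = of_nat (n + 1) * (1 - c) ^ m + of_nat m * (1 - c) ^ (m - 1) * c"
proof (induction m)
  case 0
  show ?case by (simp add: power2_eq_square fps_mult_nth)
next
  case (Suc m)
  define v where "v = 1 - fps_const c * fps_X"
  define U where "U = (fps_geom 1 :: 'a fps)"
  have vU: "v * U = fps_const (1 - c) * U + fps_const c"
    unfolding v_def U_def by (rule linear_mult_fps_geom_1)
  have "v ^ Suc m * U ^ 2 = v ^ m * (v * U) * U"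
    by (simp add: power2_eq_square ac_simps)
  also have "\<dots> = fps_const (1 - c) * (v ^ m * U ^ 2) + fps_const c * (v ^ m * U)"
    unfolding vU power2_eq_square by (simp only: distrib_left distrib_right ac_simps)
  finally have "fps_nth (v ^ Suc m * U ^ 2) n
      = (1 - c) * (of_nat (n + 1) * (1 - c) ^ m + of_nat m * (1 - c) ^ (m - 1) * c) + c * (1 - c) ^ m"
    using Suc fps_nth_linear_power_geom[of m n c] by (simp flip: v_def U_def)
  also have "(1 - c) * (of_nat m * (1 - c) ^ (m - 1) * c) = of_nat m * (1 - c) ^ m * c"
    by (cases m) (simp_all add: algebra_simps)
  then have "(1 - c) * (of_nat (n + 1) * (1 - c) ^ m + of_nat m * (1 - c) ^ (m - 1) * c) + c * (1 - c) ^ m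
    = of_nat (n + 1) * (1 - c) ^ Suc m + of_nat (Suc m) * (1 - c) ^ m * c"
    by (simp add: ring_distribs ac_simps)
  finally show ?case by (simp flip: v_def U_def)
qed

section \<open>Complete homogeneous polynomials and their generating function\<close>

text \<open>The complete homogeneous symmetric polynomial \<open>h\<^sub>i(1, y)\<close>, where \<open>y\<close> is \<^const>\<open>fps_X\<close>.\<close>

definition hsym :: "int \<Rightarrow> int fps" where
  "hsym i = (if i < 0 then 0 else (\<Sum>j\<le>nat i. fps_X ^ j))"

lemma hsym_of_nat: "hsym (int n) = (\<Sum>j\<le>n. fps_X ^ j)"
  by (simp add: hsym_def)

lemma hsym_neg: "i < 0 \<Longrightarrow> hsym i = 0"
  by (simp add: hsym_def)

text \<open>The value \<open>hsym (-1) = 0\<close> makes the geometric sum formula hold at n = 0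
  too; a factor with r_h = 1 relies on that case.\<close>

lemma one_minus_mult_hsym: "(1 - fps_X) * hsym (int n - 1) = 1 - fps_X ^ n"
proof (cases n)
  case (Suc m)
  have "(1 - fps_X) * (\<Sum>j\<le>m. fps_X ^ j) = (1 - fps_X ^ Suc m :: int fps)"
  proof (induction m)
    case (Suc m)
    have "(1 - fps_X) * (\<Sum>j\<le>Suc m. fps_X ^ j)
        = (1 - fps_X) * (\<Sum>j\<le>m. fps_X ^ j) + (1 - fps_X :: int fps) * fps_X ^ Suc m"
      by (simp add: distrib_left)
    also have "\<dots> = 1 - fps_X ^ Suc (Suc m)"
      unfolding Suc by (simp add: algebra_simps)
    finally show ?case .
  qed auto
  with Suc show ?thesis by (simp add: hsym_def)
qed (simp add: hsym_def)

text \<open>The series is in t, over the ring \<open>int fps\<close> in the variable y: the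
  coefficient of t^n in 1 / ((1 - t) (1 - y t)) collects y^j for all j up to n.\<close>

lemma fps_nth_geom_mult_geom: "fps_nth (fps_geom 1 * fps_geom fps_X) n = hsym (int n)"
  by (simp add: hsym_of_nat fps_mult_nth flip: atLeast0AtMost)
     (rule sum.reindex_bij_witness[of _ "\<lambda>i. n - i" "\<lambda>i. n - i"], auto)

text \<open>The Cauchy product of the series with itself is the image of the inner sum of the
  theorem under sigma_i -> h_i(1, y).\<close>

lemma fps_nth_geom_mult_geom_square:
  "fps_nth ((fps_geom 1 * fps_geom fps_X) ^ 2) n = (\<Sum>(i, j)\<in>{(i, j). i + j = n}. hsym (int i) * hsym (int j))"
proof -
  have "fps_nth ((fps_geom 1 * fps_geom fps_X) ^ 2) n = (\<Sum>i=0..n. hsym (int i) * hsym (int (n - i)))"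
    by (simp add: power2_eq_square fps_mult_nth[of "fps_geom 1 * fps_geom fps_X"] fps_nth_geom_mult_geom)
  also have "\<dots> = (\<Sum>(i, j)\<in>{(i, j). i + j = n}. hsym (int i) * hsym (int j))"
    by (rule sum.reindex_bij_witness[of _ fst "\<lambda>i. (i, n - i)"]) auto
  finally show ?thesis .
qed

section \<open>Coefficients in t of the expanded generating function\<close>

lemma power_eq_mult_power:
  fixes x :: "'a::monoid_mult"
  shows "n = i + j \<Longrightarrow> x ^ n = x ^ i * x ^ j"
  by (simp add: power_add)

text \<open>Two factors of each kind cancel the denominator (1 - t)^2 (1 - c t)^2 and leave a
  polynomial in t of degree at most k - 4.\<close>

lemma genfun_term_middle:
  fixes c :: "'a::comm_ring_1"
  assumes "2 \<le> s" "s + 2 \<le> k"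
  shows "fps_nth ((1 - fps_const 1 * fps_X) ^ s * (1 - fps_const c * fps_X) ^ (k - s) * (fps_geom 1 * fps_geom c) ^ 2) (k - 3) = 0"
proof -
  define u v U V where "u = (1 - fps_const 1 * fps_X :: 'a fps)" and "v = 1 - fps_const c * fps_X"
    and "U = (fps_geom 1 :: 'a fps)" and "V = fps_geom c"
  note defs = this
  have inv: "u * U = 1" "v * V = 1"
    unfolding defs by (rule linear_mult_fps_geom)+
  have "u ^ s = u ^ (s - 2) * u ^ 2" "v ^ (k - s) = v ^ (k - s - 2) * v ^ 2"
    by (rule power_eq_mult_power; use assms in simp)+
  then have "u ^ s * v ^ (k - s) * (U * V) ^ 2 = u ^ (s - 2) * v ^ (k - s - 2) * (u * U) ^ 2 * (v * V) ^ 2"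
    by (simp only: power_mult_distrib ac_simps)
  also have "\<dots> = u ^ (s - 2) * v ^ (k - s - 2)"
    by (simp add: inv)
  also have "fps_nth \<dots> (k - 3) = 0"
    unfolding defs
    using assms by (intro fps_nth_mult_eq_0[of "s - 2" _ "k - s - 2"] fps_nth_linear_power_eq_0) auto
  finally show ?thesis unfolding defs .
qed

text \<open>After cancellation (1 - c t)^(k-2) / (1 - t)^2 remains. Its coefficient is (k - 2) (1 -
  c)^(k-3) times (1 - c) + c.\<close>

lemma genfun_term_0:
  fixes c :: "'a::comm_ring_1"
  assumes "k \<ge> 3"
  shows "fps_nth ((1 - fps_const c * fps_X) ^ k * (fps_geom 1 * fps_geom c) ^ 2) (k - 3)
    = of_nat (k - 2) * (1 - c) ^ (k - 3)"
proof -
  define v U V where "v = 1 - fps_const c * fps_X"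
    and "U = (fps_geom 1 :: 'a fps)" and "V = fps_geom c"
  note defs = this
  have inv: "v * V = 1"
    unfolding defs by (rule linear_mult_fps_geom)
  have "v ^ k = v ^ (k - 2) * v ^ 2"
    by (rule power_eq_mult_power) (use assms in simp)
  then have "v ^ k * (U * V) ^ 2 = v ^ (k - 2) * U ^ 2 * (v * V) ^ 2"
    by (simp only: power_mult_distrib ac_simps)
  also have "\<dots> = v ^ (k - 2) * U ^ 2"
    by (simp add: inv)
  also have "fps_nth \<dots> (k - 3) = of_nat (k - 3 + 1) * (1 - c) ^ (k - 2) + of_nat (k - 2) * (1 - c) ^ (k - 2 - 1) * c"
    unfolding defs using assms by (intro fps_nth_linear_power_geom_square) auto
  also have "\<dots> = of_nat (k - 2) * (1 - c) ^ (k - 3)"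
  proof -
    obtain m where "k = m + 3" using assms by (metis add.commute le_Suc_ex)
    then show ?thesis by (simp add: algebra_simps)
  qed
  finally show ?thesis unfolding defs .
qed

text \<open>After cancellation (1 - c t)^(k-3) / (1 - t) remains, and its coefficient at t^(k-3) is
  the value of the numerator at t = 1.\<close>

lemma genfun_term_1:
  fixes c :: "'a::comm_ring_1"
  assumes "k \<ge> 3"
  shows "fps_nth ((1 - fps_const 1 * fps_X) * (1 - fps_const c * fps_X) ^ (k - 1) * (fps_geom 1 * fps_geom c) ^ 2) (k - 3)
    = (1 - c) ^ (k - 3)"
proof -
  define u v U V where "u = (1 - fps_const 1 * fps_X :: 'a fps)" and "v = 1 - fps_const c * fps_X"
    and "U = (fps_geom 1 :: 'a fps)" and "V = fps_geom c"
  note defs = this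
  have inv: "u * U = 1" "v * V = 1"
    unfolding defs by (rule linear_mult_fps_geom)+
  have "v ^ (k - 1) = v ^ (k - 3) * v ^ 2"
    by (rule power_eq_mult_power) (use assms in simp)
  then have "u * v ^ (k - 1) * (U * V) ^ 2 = v ^ (k - 3) * U * (u * U) * (v * V) ^ 2"
    by (simp only: power_mult_distrib power2_eq_square ac_simps)
  also have "\<dots> = v ^ (k - 3) * U"
    by (simp add: inv)
  finally show ?thesis
    using fps_nth_linear_power_geom[of "k - 3" "k - 3" c] by (simp only: defs)
qed

text \<open>A series in t over series in y: the \<open>fps_X\<close> inside \<open>fps_const\<close>
  and \<open>fps_geom\<close> is y, the other one is t. Choosing the t-free term of factor h puts h
  into I, choosing the other term puts it into J.\<close>

abbreviation genfun :: "nat \<Rightarrow> (nat \<Rightarrow> nat) \<Rightarrow> int fps fps" where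
  "genfun k r \<equiv> (\<Prod>h\<in>{1..k}. fps_const (hsym (int (r h) - 1)) + fps_const (- fps_X * hsym (int (r h) - 2)) * fps_X)
       * (fps_geom 1 * fps_geom fps_X) ^ 2"

text \<open>One factor w = 1 - y for each h turns the sums \<open>hsym\<close> into binomials, so
  that the h-th factor becomes (1 - y t) - y^(r_h) (1 - t). The product is then expanded over the
  set S of second terms.\<close>

lemma coeff_genfun:
  fixes r :: "nat \<Rightarrow> nat"
  assumes pos: "\<And>h. h \<in> {1..k} \<Longrightarrow> r h > 0"
  defines "w \<equiv> 1 - fps_X :: int fps"
  shows "w ^ k * fps_nth (genfun k r) (k - 3) = (\<Sum>S\<in>Pow {1..k}. (-1) ^ card S * fps_X ^ (\<Sum>h\<in>S. r h) *
     fps_nth ((1 - fps_const 1 * fps_X) ^ card S * (1 - fps_const fps_X * fps_X) ^ (k - card S) * (fps_geom 1 * fps_geom fps_X) ^ 2) (k - 3))"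
proof -
  let ?u = "1 - fps_const 1 * fps_X :: int fps fps" and ?v = "1 - fps_const fps_X * fps_X :: int fps fps"
  let ?W = "(fps_geom 1 * fps_geom fps_X) ^ 2 :: int fps fps"
  have factor: "fps_const w * (fps_const (hsym (int (r h) - 1)) + fps_const (- fps_X * hsym (int (r h) - 2)) * fps_X)
      = ?v - fps_const (fps_X ^ r h) * ?u" if h: "h \<in> {1..k}" for h
  proof -
    obtain m where m: "r h = Suc m" using pos[OF h] by (cases "r h") auto
    have a: "w * hsym (int (r h) - 1) = 1 - fps_X ^ r h"
      unfolding w_def by (rule one_minus_mult_hsym)
    have "w * hsym (int m - 1) = 1 - fps_X ^ m"
      unfolding w_def by (rule one_minus_mult_hsym)
    then have b: "w * (- fps_X * hsym (int (r h) - 2)) = fps_X ^ r h - fps_X"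
      unfolding m by (simp add: mult.left_commute) (simp add: algebra_simps)
    have "fps_const w * (fps_const (hsym (int (r h) - 1)) + fps_const (- fps_X * hsym (int (r h) - 2)) * fps_X)
      = fps_const (w * hsym (int (r h) - 1)) + fps_const (w * (- fps_X * hsym (int (r h) - 2))) * fps_X"
      by (simp only: distrib_left fps_const_mult flip: mult.assoc)
    also have "\<dots> = ?v - fps_const (fps_X ^ r h) * ?u"
      unfolding a b by (simp add: algebra_simps flip: fps_const_sub)
    finally show ?thesis .
  qed
  have "fps_const w ^ k * genfun k r = (\<Prod>h\<in>{1..k}. fps_const w * (fps_const (hsym (int (r h) - 1)) + fps_const (- fps_X * hsym (int (r h) - 2)) * fps_X)) * ?W"
    by (simp only: prod.distrib prod_constant mult.assoc) simp
  also have "(\<Prod>h\<in>{1..k}. fps_const w * (fps_const (hsym (int (r h) - 1)) + fps_const (- fps_X * hsym (int (r h) - 2)) * fps_X))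
     = (\<Prod>h\<in>{1..k}. ?v - fps_const (fps_X ^ r h) * ?u)"
    using factor by (intro prod.cong) auto
  also have "\<dots> = (\<Sum>S\<in>Pow {1..k}. (-1) ^ card S * (\<Prod>h\<in>S. fps_const (fps_X ^ r h) * ?u) * (\<Prod>h\<in>{1..k} - S. ?v))"
    by (rule prod_diff_conv_sum) simp
  also have "\<dots> = (\<Sum>S\<in>Pow {1..k}. fps_const ((-1) ^ card S * fps_X ^ (\<Sum>h\<in>S. r h)) * (?u ^ card S * ?v ^ (k - card S)))"
  proof (rule sum.cong[OF refl])
    fix S assume "S \<in> Pow {1..k}"
    then have S: "S \<subseteq> {1..k}" by simp
    have c: "(\<Prod>h\<in>S. fps_const (fps_X ^ r h)) = (fps_const (fps_X ^ (\<Sum>h\<in>S. r h)) :: int fps fps)"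
      using finite_subset[OF S finite_atLeastAtMost] by induction (simp_all add: power_add)
    have "card ({1..k} - S) = k - card S"
      using S by (simp add: card_Diff_subset finite_subset)
    moreover have "((-1) ^ card S :: int fps fps) = fps_const ((-1) ^ card S)"
      by (simp flip: fps_const_power fps_const_neg)
    ultimately show "(-1) ^ card S * (\<Prod>h\<in>S. fps_const (fps_X ^ r h) * ?u) * (\<Prod>h\<in>{1..k} - S. ?v)
      = fps_const ((-1) ^ card S * fps_X ^ (\<Sum>h\<in>S. r h)) * (?u ^ card S * ?v ^ (k - card S))"
      by (simp only: prod.distrib c prod_constant fps_const_mult[symmetric] mult.assoc)
  qed
  finally have "fps_const w ^ k * genfun k r = (\<Sum>S\<in>Pow {1..k}. fps_const ((-1) ^ card S * fps_X ^ (\<Sum>h\<in>S. r h)) * (?u ^ card S * ?v ^ (k - card S) * ?W))"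
    by (simp only: sum_distrib_right mult.assoc)
  then have "fps_nth (fps_const (w ^ k) * genfun k r) (k - 3) = fps_nth (\<Sum>S\<in>Pow {1..k}. fps_const ((-1) ^ card S * fps_X ^ (\<Sum>h\<in>S. r h)) * (?u ^ card S * ?v ^ (k - card S) * ?W)) (k - 3)"
    by (simp only: fps_const_power)
  then show ?thesis
    by (simp only: fps_sum_nth fps_mult_left_const_nth)
qed

text \<open>The coefficient wanted in the end is that of y^(l+1), so it suffices to work modulo
  y^(l+2). The subtracted term is the contribution of the sets S with at most one element.\<close>

lemma coeff_genfun_cong:
  fixes r :: "nat \<Rightarrow> nat"
  assumes pos: "\<And>h. h \<in> {1..k} \<Longrightarrow> r h > 0"
    and total: "3 + 2 * l = (\<Sum>h=1..k. r h)"
    and le: "\<And>h. h \<in> {1..k} \<Longrightarrow> r h \<le> l + 1"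
    and k: "k \<ge> 3"
  defines "w \<equiv> 1 - fps_X :: int fps"
  shows "fps_X ^ (l + 2) dvd
    w ^ k * fps_nth (genfun k r) (k - 3) - w ^ (k - 3) * (of_nat (k - 2) - (\<Sum>h=1..k. fps_X ^ r h))"
proof -
  define F :: "nat set \<Rightarrow> int fps" where "F S = (-1) ^ card S * fps_X ^ (\<Sum>h\<in>S. r h) *
     fps_nth ((1 - fps_const 1 * fps_X) ^ card S * (1 - fps_const fps_X * fps_X) ^ (k - card S) * (fps_geom 1 * fps_geom fps_X) ^ 2) (k - 3)"
    for S
  define T where "T = (\<lambda>h. {h}) ` {1..k}"
  have coeff: "w ^ k * fps_nth (genfun k r) (k - 3) = (\<Sum>S\<in>Pow {1..k}. F S)"
    unfolding w_def F_def by (rule coeff_genfun) (rule pos)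
  \<comment> \<open>Sort the sets S by size: the empty set, the singletons collected in
    \<open>T\<close>, and those with at least two elements.\<close>
  have "Pow {1..k} = insert {} (T \<union> (Pow {1..k} - insert {} T))"
    unfolding T_def by auto
  then have "(\<Sum>S\<in>Pow {1..k}. F S) = (\<Sum>S\<in>insert {} (T \<union> (Pow {1..k} - insert {} T)). F S)"
    by simp
  also have "\<dots> = F {} + (\<Sum>S\<in>T \<union> (Pow {1..k} - insert {} T). F S)"
    by (rule sum.insert) (auto simp: T_def)
  also have "(\<Sum>S\<in>T \<union> (Pow {1..k} - insert {} T). F S) = (\<Sum>S\<in>T. F S) + (\<Sum>S\<in>Pow {1..k} - insert {} T. F S)"
    by (rule sum.union_disjoint) (auto simp: T_def)
  also have "F {} = w ^ (k - 3) * of_nat (k - 2)"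
    using genfun_term_0[OF k, of "fps_X :: int fps"] by (simp add: F_def w_def mult.commute)
  also have "(\<Sum>S\<in>T. F S) = (\<Sum>h=1..k. F {h})"
    unfolding T_def by (subst sum.reindex) auto
  also have "\<dots> = (\<Sum>h=1..k. - (w ^ (k - 3) * fps_X ^ r h))"
    using genfun_term_1[OF k, of "fps_X :: int fps"]
    by (intro sum.cong) (simp_all add: F_def w_def mult.commute)
  also have "\<dots> = - (w ^ (k - 3) * (\<Sum>h=1..k. fps_X ^ r h))"
    by (simp add: sum_negf sum_distrib_left)
  finally have eq: "w ^ k * fps_nth (genfun k r) (k - 3) - w ^ (k - 3) * (of_nat (k - 2) - (\<Sum>h=1..k. fps_X ^ r h))
     = (\<Sum>S\<in>Pow {1..k} - insert {} T. F S)"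
    unfolding coeff by (simp only: right_diff_distrib) simp
  have "fps_X ^ (l + 2) dvd F S" if S: "S \<in> Pow {1..k} - insert {} T" for S
  proof -
    have sub: "S \<subseteq> {1..k}" and fin: "finite S"
      using S finite_subset[of S "{1..k}"] by auto
    have "card S \<noteq> 0" "card S \<noteq> 1"
      using S fin by (auto simp: T_def card_1_singleton_iff)
    then have s2: "2 \<le> card S" by linarith
    show ?thesis
    proof (cases "card S + 2 \<le> k")
      case True
      then have "F S = 0"
        unfolding F_def genfun_term_middle[OF s2 True] by simp
      then show ?thesis by simp
    next
      case False
      have "card ({1..k} - S) = k - card S"
        using sub by (simp add: card_Diff_subset fin)
      \<comment> \<open>At most one index lies outside S, and its r_h is at most l + 1, so the
        exponent of y is at least (3 + 2 l) - (l + 1) = l + 2.\<close>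
      then have small: "card ({1..k} - S) \<le> 1"
        using False by simp
      have "(\<Sum>h\<in>{1..k} - S. r h) \<le> card ({1..k} - S) * (l + 1)"
        using sum_bounded_above[of "{1..k} - S" r "l + 1"] le by simp
      also have "\<dots> \<le> l + 1"
        using mult_le_mono1[OF small, of "l + 1"] by simp
      finally have "(\<Sum>h\<in>{1..k} - S. r h) \<le> l + 1" .
      moreover have "(\<Sum>h\<in>{1..k} - S. r h) + (\<Sum>h\<in>S. r h) = 3 + 2 * l"
        unfolding total by (rule sum.subset_diff[symmetric, OF sub]) simp
      ultimately have "l + 2 \<le> (\<Sum>h\<in>S. r h)" by linarith
      then have "fps_X ^ (l + 2) dvd (fps_X ^ (\<Sum>h\<in>S. r h) :: int fps)"
        by (rule le_imp_power_dvd)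
      then show ?thesis unfolding F_def by (simp add: dvd_mult dvd_mult2)
    qed
  qed
  then show ?thesis
    unfolding eq by (intro dvd_sum) auto
qed

text \<open>Multiplying the congruence by (1 - y)^(1-k) leaves (1 - y) Q = P / (1 - y)^2 modulo
  y^(l+2), and 1 / (1 - y)^2 has the coefficients n + 1.\<close>

lemma coeff_genfun_eq_1:
  fixes r :: "nat \<Rightarrow> nat"
  assumes pos: "\<And>h. h \<in> {1..k} \<Longrightarrow> r h > 0"
    and total: "3 + 2 * l = (\<Sum>h=1..k. r h)"
    and le: "\<And>h. h \<in> {1..k} \<Longrightarrow> r h \<le> l + 1"
    and k: "k \<ge> 3"
  shows "fps_nth ((fps_X - 1) * fps_nth (genfun k r) (k - 3)) (l + 1) = 1"
proof -
  define w where "w = (1 - fps_X :: int fps)"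
  define g where "g = (fps_geom 1 :: int fps)"
  define Q where "Q = fps_nth (genfun k r) (k - 3)"
  define P where "P = (of_nat (k - 2) - (\<Sum>h=1..k. fps_X ^ r h) :: int fps)"
  have wg: "w ^ n * g ^ n = 1" for n
    using linear_mult_fps_geom[of "1::int"] by (simp add: w_def g_def flip: power_mult_distrib)
  have "fps_X ^ (l + 2) dvd g ^ (k - 1) * (w ^ k * Q - w ^ (k - 3) * P)"
    unfolding w_def Q_def P_def by (intro dvd_mult coeff_genfun_cong[OF pos total le k])
  also have "g ^ (k - 1) * (w ^ k * Q - w ^ (k - 3) * P) = w * Q - g ^ 2 * P"
  proof -
    have "w ^ k = w ^ 1 * w ^ (k - 1)" "g ^ (k - 1) = g ^ 2 * g ^ (k - 3)"
      by (rule power_eq_mult_power; use k in simp)+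
    moreover have "g ^ (k - 1) * (w ^ k * Q) = w * Q" 
      using wg[of "k - 1"] calculation(1) by (simp add: ac_simps)
    moreover have "g ^ (k - 1) * (w ^ (k - 3) * P) = g ^ 2 * P"
      using wg[of "k - 3"] calculation(2) by (simp add: ac_simps)
    ultimately show ?thesis by (simp only: right_diff_distrib)
  qed
  finally have "fps_nth (w * Q - g ^ 2 * P) (l + 1) = 0"
    by (elim dvdE) (simp only: fps_X_power_mult_nth, simp)
  moreover have "(fps_X - 1) * Q = - (w * Q)"
    by (simp add: w_def algebra_simps)
  moreover have g2: "fps_nth (g ^ 2) n = int (n + 1)" for n
    by (simp add: g_def power2_eq_square fps_mult_nth)
  have "fps_nth (g ^ 2 * P) (l + 1) = - 1"
  proof -
    have "g ^ 2 * P = of_nat (k - 2) * g ^ 2 - (\<Sum>h=1..k. fps_X ^ r h * g ^ 2)"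
      by (simp add: P_def algebra_simps sum_distrib_left)
    moreover have "fps_nth (of_nat (k - 2) * g ^ 2) (l + 1) = int (k - 2) * int (l + 2)"
      by (simp add: fps_of_nat[symmetric] g2)
    moreover have "(\<Sum>h=1..k. fps_nth (fps_X ^ r h * g ^ 2) (l + 1)) = (\<Sum>h=1..k. int (l + 2) - int (r h))"
    proof (rule sum.cong[OF refl])
      fix h assume "h \<in> {1..k}"
      from le[OF this] show "fps_nth (fps_X ^ r h * g ^ 2) (l + 1) = int (l + 2) - int (r h)"
        by (simp only: fps_X_power_mult_nth g2) simp
    qed
    ultimately have "fps_nth (g ^ 2 * P) (l + 1) = int (k - 2) * int (l + 2) - (\<Sum>h=1..k. int (l + 2) - int (r h))"
      by (simp add: fps_sum_nth)
    \<comment> \<open>With the r_h summing to 3 + 2 l this is -2 (l + 2) + 3 + 2 l = -1.\<close>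
    also have "\<dots> = int (k - 2) * int (l + 2) - int k * int (l + 2) + int (\<Sum>h=1..k. r h)"
      by (simp add: sum_subtractf)
    also have "int (k - 2) = int k - 2" using k by simp
    finally show ?thesis
      unfolding total[symmetric] by (simp add: algebra_simps)
  qed
  ultimately show ?thesis unfolding Q_def[symmetric] by simp
qed

section \<open>Integration over the Grassmannian\<close>

definition std_vec :: "nat \<Rightarrow> nat \<Rightarrow> complex" where
  "std_vec i = (\<lambda>j. if j = i then 1 else 0)"

lemma std_vec_nonzero: "std_vec i \<noteq> 0"
  by (metis std_vec_def zero_fun_apply zero_neq_one)

lemma cspan_std_vec: "cspan {std_vec i} = {x. \<forall>j. j \<noteq> i \<longrightarrow> x j = 0}"
proof -
  have "x \<in> range (\<lambda>c j. c * std_vec i j)" if "\<forall>j. j \<noteq> i \<longrightarrow> x j = 0" for x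
    using that by (intro range_eqI[of _ _ "x i"]) (auto simp: std_vec_def)
  then show ?thesis
    unfolding cvec.span_singleton by (auto simp: std_vec_def)
qed

lemma independent_std_vecs: "cvec.independent {std_vec 0, std_vec 1}"
proof -
  have "std_vec 0 \<notin> cspan {std_vec 1}"
    by (auto simp: cspan_std_vec) (auto simp: std_vec_def)
  then show ?thesis
    by (intro cvec.independent_insertI) (simp_all add: std_vec_nonzero cvec.independent_empty)
qed

lemma card_std_vecs: "card {std_vec 0, std_vec 1} = 2"
proof -
  have "std_vec 0 0 \<noteq> std_vec 1 0" by (simp add: std_vec_def)
  then have "std_vec 0 \<noteq> std_vec 1" by metis
  then show ?thesis by simp
qed

lemma cdim_cspan_std_vec: "cdim (cspan {std_vec i}) = 1"
proof -
  have "cvec.independent {std_vec i}" by (simp add: std_vec_nonzero)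
  then show ?thesis by (simp add: cvec.dim_eq_card_independent)
qed

lemma cspan_std_vec_subset: "i < N \<Longrightarrow> cspan {std_vec i} \<subseteq> cspace N"
  by (auto simp: cspan_std_vec cspace_def)

lemma csubspace_cspace: "csubspace (cspace N)"
  by (auto simp: cvec.subspace_def cspace_def)

text \<open>A nonzero vector of the line is a multiple of \<open>std_vec i\<close>, so a subspace
  meets the line nontrivially exactly when it contains the generator.\<close>

lemma special_schubert_std_vec:
  "special_schubert N (cspan {std_vec i}) = {V \<in> Gr2 N. std_vec i \<in> V}"
proof -
  have "V \<inter> cspan {std_vec i} \<noteq> {0} \<longleftrightarrow> std_vec i \<in> V" if V: "V \<in> Gr2 N" for V
  proof
    have sub: "csubspace V" using V by (simp add: Gr2_def)
    assume "V \<inter> cspan {std_vec i} \<noteq> {0}"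
    \<comment> \<open>Both sets contain 0, so an intersection other than {0} has a nonzero element
      and is not just empty.\<close>
    moreover have "0 \<in> V \<inter> cspan {std_vec i}"
      using cvec.subspace_0[OF sub] cvec.span_zero by auto
    ultimately obtain x where x: "x \<in> V" "x \<in> cspan {std_vec i}" "x \<noteq> 0" by blast
    then have x0: "\<forall>j. j \<noteq> i \<longrightarrow> x j = 0" by (simp add: cspan_std_vec)
    then have "x i \<noteq> 0" using x(3) by (auto simp: fun_eq_iff)
    then have "std_vec i = (\<lambda>j. inverse (x i) * x j)"
      using x0 by (auto simp: std_vec_def fun_eq_iff)
    then show "std_vec i \<in> V" using cvec.subspace_scale[OF sub x(1), of "inverse (x i)"] by simp
  next
    assume "std_vec i \<in> V"
    moreover have "std_vec i \<in> cspan {std_vec i}" by (simp add: cvec.span_base)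
    ultimately show "V \<inter> cspan {std_vec i} \<noteq> {0}" using std_vec_nonzero by blast
  qed
  then show ?thesis unfolding special_schubert_def by blast
qed

text \<open>A basis vector of V outside the span would give three independent vectors in a space
  spanned by two.\<close>

lemma Gr2_eq_cspan:
  assumes V: "V \<in> Gr2 N" and "std_vec 0 \<in> V" "std_vec 1 \<in> V"
  shows "V = cspan {std_vec 0, std_vec 1}"
proof -
  let ?S = "{std_vec 0, std_vec 1}"
  have sub: "csubspace V" and dim: "cdim V = 2" using V by (simp_all add: Gr2_def)
  obtain B where B: "B \<subseteq> V" "cvec.independent B" "V \<subseteq> cspan B" "card B = cdim V"
    by (rule cvec.basis_exists)
  have finB: "finite B" using B(4) dim by (intro card_ge_0_finite) simp
  have "B \<subseteq> cspan ?S"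
  proof
    fix b assume b: "b \<in> B"
    show "b \<in> cspan ?S"
    proof (rule ccontr)
      assume n: "b \<notin> cspan ?S"
      then have "cvec.independent (insert b ?S)"
        by (intro cvec.independent_insertI independent_std_vecs) 
      moreover have "insert b ?S \<subseteq> cspan B"
        using b B assms by auto
      ultimately have "card (insert b ?S) \<le> card B"
        using cvec.independent_span_bound[OF finB] by blast
      moreover have "b \<notin> ?S" using n cvec.span_base by blast
      then have "card (insert b ?S) = 3" using card_std_vecs by simp
      ultimately show False using B(4) dim by simp
    qed
  qed
  then have "V \<subseteq> cspan ?S"
    using B(3) cvec.span_minimal cvec.subspace_span by blast
  moreover have "cspan ?S \<subseteq> V"
    using assms by (intro cvec.span_minimal sub) auto
  ultimately show ?thesis by blast
qed

lemma cspan_std_vecs_Gr2: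
  assumes "N \<ge> 2"
  shows "cspan {std_vec 0, std_vec 1} \<in> Gr2 N"
proof -
  have "cdim (cspan {std_vec 0, std_vec 1}) = 2"
    using cvec.dim_eq_card_independent[OF independent_std_vecs] card_std_vecs by simp
  moreover have "cspan {std_vec 0, std_vec 1} \<subseteq> cspace N"
    using assms by (intro cvec.span_minimal csubspace_cspace) (auto simp: cspace_def std_vec_def)
  ultimately show ?thesis by (simp add: Gr2_def cvec.subspace_span)
qed

section \<open>Segre classes and the square of the top one\<close>

context Gr2_intersection_ring
begin

lemma chern_sub_closed: "chern_sub R i \<in> carrier R"
  using subgroup.mem_carrier[OF grade_subgroup chern_sub_grade] by simp

lemma chern_quot_closed: "chern_quot R i \<in> carrier R"
  using subgroup.mem_carrier[OF grade_subgroup chern_quot_grade] by simp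

lemma chern_quot_rec_1: "chern_quot R (Suc 0) = \<ominus> chern_sub R 1"
proof -
  have "(\<Oplus>i\<in>{..Suc 0}. chern_sub R i \<otimes> chern_quot R (Suc 0 - i)) = \<zero>"
    by (rule whitney) simp
  then have "chern_sub R 1 \<oplus> chern_quot R 1 = \<zero>"
    using chern_sub_closed chern_quot_closed by (simp add: chern_sub_0 chern_quot_0)
  then show ?thesis
    using chern_sub_closed chern_quot_closed by (metis One_nat_def a_comm minus_equality)
qed

text \<open>This is the degree n + 2 part of c(V) c(Q) = 1, where the rank of V leaves only the
  terms with i at most 2.\<close>

lemma chern_quot_rec_2:
  "chern_quot R (Suc (Suc n)) = \<ominus> (chern_sub R 1 \<otimes> chern_quot R (Suc n) \<oplus> chern_sub R 2 \<otimes> chern_quot R n)"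
proof -
  let ?f = "\<lambda>i. chern_sub R i \<otimes> chern_quot R (Suc (Suc n) - i)"
  have "(\<Oplus>i\<in>{..Suc (Suc n)}. ?f i) = \<zero>"
    by (rule whitney) simp
  also have "(\<Oplus>i\<in>{..Suc (Suc n)}. ?f i) = (\<Oplus>i\<in>{..2}. ?f i)"
    using chern_sub_closed chern_quot_closed
    by (intro add.finprod_mono_neutral_cong_right) (auto simp: rank_sub)
  also have "\<dots> = ?f 2 \<oplus> (?f 1 \<oplus> ?f 0)"
    using chern_sub_closed chern_quot_closed by (simp add: numeral_2_eq_2)
  finally show ?thesis
    using chern_sub_closed chern_quot_closed
    by (intro minus_equality[symmetric]) (simp_all add: chern_sub_0 a_ac)
qed

text \<open>Both sequences obey the same recursion with the same initial values. Vanishing above N -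
  2 and the description by Schubert loci thereby pass to the Segre classes.\<close>

lemma segre_eq_chern_quot: "segre R n = chern_quot R n"
  by (induction n rule: induct_nat_012) (simp_all add: chern_quot_0 chern_quot_rec_1 chern_quot_rec_2)

lemma sigma_closed [simp]: "\<sigma> R i \<in> carrier R"
  by (simp add: \<sigma>_def segre_eq_chern_quot chern_quot_closed)

lemma sigma_neg: "i < 0 \<Longrightarrow> \<sigma> R i = \<zero>"
  by (simp add: \<sigma>_def)

lemma sigma_0: "\<sigma> R 0 = \<one>"
  by (simp add: \<sigma>_def)

lemma sigma_large: "i > int (N - 2) \<Longrightarrow> \<sigma> R i = \<zero>"
  by (auto simp: \<sigma>_def segre_eq_chern_quot intro!: rank_quot)

text \<open>Since \<open>\<sigma> R (-1)\<close> is zero, a single recursion also covers i =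
  0.\<close>

lemma sigma_rec:
  assumes "i \<ge> 0"
  shows "\<sigma> R (i + 1) = \<ominus> (chern_sub R 1 \<otimes> \<sigma> R i \<oplus> chern_sub R 2 \<otimes> \<sigma> R (i - 1))"
proof (cases "nat i")
  case 0
  with assms have "i = 0" by simp
  then show ?thesis using chern_sub_closed by (simp add: \<sigma>_def)
next
  case (Suc m)
  then have "i = int m + 1" by simp
  then show ?thesis by (simp add: \<sigma>_def nat_add_distrib)
qed

text \<open>The class sigma_(N-2) is that of the planes containing a given line. Exactly one plane
  contains two different lines, so the square is the class of a point.\<close>

lemma integral_top_square:
  assumes "N \<ge> 2"
  shows "gr_integral R (\<sigma> R (int N - 2) \<otimes> \<sigma> R (int N - 2)) = 1"
proof -
  let ?F = "\<lambda>i. cspan {std_vec i}"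
  \<comment> \<open>\<open>degeneracy\<close> is applied in codimension N - 2, where F has dimension
    1.\<close>
  have cl: "cyc R (special_schubert N (?F i)) = chern_quot R (N - 2)" if "i < 2" for i
    using that assms
    using cdim_cspan_std_vec[of i] cspan_std_vec_subset[of i N] by (intro degeneracy) (simp_all add: cvec.subspace_span del: cvec.dim_span)
  have "std_vec 0 \<in> ?F 0" "std_vec 0 \<notin> ?F 1"
    by (auto simp: cspan_std_vec) (auto simp: std_vec_def)
  then have ne: "?F 0 \<noteq> ?F 1" by metis
  have "special_schubert N (?F 0) \<inter> special_schubert N (?F 1) = {cspan {std_vec 0, std_vec 1}}"
    unfolding special_schubert_std_vec
  proof (intro equalityI subsetI)
    fix V assume "V \<in> {V \<in> Gr2 N. std_vec 0 \<in> V} \<inter> {V \<in> Gr2 N. std_vec 1 \<in> V}"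
    then show "V \<in> {cspan {std_vec 0, std_vec 1}}"
      using Gr2_eq_cspan by blast
  next
    fix V assume V: "V \<in> {cspan {std_vec 0, std_vec 1}}"
    have "std_vec 0 \<in> cspan {std_vec 0, std_vec 1}" "std_vec 1 \<in> cspan {std_vec 0, std_vec 1}"
      by (rule cvec.span_base, simp)+
    with V show "V \<in> {V \<in> Gr2 N. std_vec 0 \<in> V} \<inter> {V \<in> Gr2 N. std_vec 1 \<in> V}"
      using cspan_std_vecs_Gr2[OF assms] by blast
  qed
  then have "chern_quot R (N - 2) \<otimes> chern_quot R (N - 2) = cyc R {cspan {std_vec 0, std_vec 1}}"
    using transverse[of "?F 0" "?F 1"] assms cl[of 0] cl[of 1] ne
    by (simp add: cvec.subspace_span cdim_cspan_std_vec cspan_std_vec_subset del: cvec.dim_span)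
  moreover have "\<sigma> R (int N - 2) = chern_quot R (N - 2)"
    using assms by (simp add: \<sigma>_def segre_eq_chern_quot nat_diff_distrib)
  ultimately show ?thesis
    using integral_point[OF cspan_std_vecs_Gr2[OF assms]] by simp
qed

end

section \<open>Alternants, the Pieri rule and the integrals of alternants\<close>

context Gr2_intersection_ring
begin

text \<open>
  The formal quotient \<open>(x\<^sup>p y\<^sup>q - x\<^sup>q y\<^sup>p) / (x - y)\<close> in the Chern roots \<open>x\<close>, \<open>y\<close> of the dual of
  the universal subbundle.
\<close>

definition alternant :: "int \<Rightarrow> int \<Rightarrow> 'a" where
  "alternant p q = \<sigma> R (p - 1) \<otimes> \<sigma> R q \<ominus> \<sigma> R p \<otimes> \<sigma> R (q - 1)"

lemma alternant_closed [simp]: "alternant p q \<in> carrier R"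
  by (simp add: alternant_def)

lemma alternant_swap: "alternant q p = \<ominus> alternant p q"
proof -
  have "a \<otimes> b \<ominus> c \<otimes> d = \<ominus> (d \<otimes> c \<ominus> b \<otimes> a)"
    if "a \<in> carrier R" "b \<in> carrier R" "c \<in> carrier R" "d \<in> carrier R" for a b c d
    using that by algebra
  from this[OF sigma_closed sigma_closed sigma_closed sigma_closed]
  show ?thesis unfolding alternant_def .
qed

lemma alternant_1_0: "alternant 1 0 = \<one>"
  by (simp add: alternant_def sigma_0 sigma_neg minus_eq)

text \<open>In the Chern roots, -c_1 = x + y raises one exponent at a time and c_2 = x y raises
  both. Expanding sigma_(p+1) and sigma_(q+1) by \<open>sigma_rec\<close> reduces this to polynomial
  identities.\<close>

lemma chern_mult_alternant:
  assumes "p \<ge> 0" "q \<ge> 0"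
  shows "\<ominus> chern_sub R 1 \<otimes> alternant p q = alternant (p + 1) q \<oplus> alternant p (q + 1)"
    and "chern_sub R 2 \<otimes> alternant p q = alternant (p + 1) (q + 1)"
proof -
  \<comment> \<open>Here s0, s1 stand for sigma_(p-1), sigma_p and t0, t1 for sigma_(q-1),
    sigma_q.\<close>
  have *: "\<ominus> c1 \<otimes> (s0 \<otimes> t1 \<ominus> s1 \<otimes> t0)
      = (s1 \<otimes> t1 \<ominus> \<ominus> (c1 \<otimes> s1 \<oplus> c2 \<otimes> s0) \<otimes> t0) \<oplus> (s0 \<otimes> \<ominus> (c1 \<otimes> t1 \<oplus> c2 \<otimes> t0) \<ominus> s1 \<otimes> t1)"
    "c2 \<otimes> (s0 \<otimes> t1 \<ominus> s1 \<otimes> t0)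
      = s1 \<otimes> \<ominus> (c1 \<otimes> t1 \<oplus> c2 \<otimes> t0) \<ominus> \<ominus> (c1 \<otimes> s1 \<oplus> c2 \<otimes> s0) \<otimes> t1"
    if "s0 \<in> carrier R" "s1 \<in> carrier R" "t0 \<in> carrier R" "t1 \<in> carrier R"
      "c1 \<in> carrier R" "c2 \<in> carrier R" for s0 s1 t0 t1 c1 c2
    using that by algebra+
  show "\<ominus> chern_sub R 1 \<otimes> alternant p q = alternant (p + 1) q \<oplus> alternant p (q + 1)"
    unfolding alternant_def add_diff_cancel_right' sigma_rec[OF assms(1)] sigma_rec[OF assms(2)]
    by (rule *(1)) (simp_all add: chern_sub_closed)
  show "chern_sub R 2 \<otimes> alternant p q = alternant (p + 1) (q + 1)"
    unfolding alternant_def add_diff_cancel_right' sigma_rec[OF assms(1)] sigma_rec[OF assms(2)]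
    by (rule *(2)) (simp_all add: chern_sub_closed)
qed

lemma integral_zero: "gr_integral R \<zero> = 0"
  using integral_add[of \<zero> \<zero>] by simp

lemma integral_neg:
  assumes "x \<in> carrier R"
  shows "gr_integral R (\<ominus> x) = - gr_integral R x"
  using integral_add[of x "\<ominus> x"] assms by (simp add: r_neg integral_zero)

lemma integral_diff:
  assumes "x \<in> carrier R" "y \<in> carrier R"
  shows "gr_integral R (x \<ominus> y) = gr_integral R x - gr_integral R y"
  using assms by (simp add: minus_eq integral_add integral_neg)

text \<open>Multiply x^p y^q - x^q y^p by the symmetric h_m, the sum of the x^(m-i) y^i. Terms that
  cancel by antisymmetry are kept, so the sum has no truncation. The free factor z allows the
  factors of a product to be removed one at a time.\<close>

lemma integral_pieri:
  assumes z: "z \<in> carrier R"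
  shows "gr_integral R (z \<otimes> (\<sigma> R (int m) \<otimes> alternant (int p) (int q)))
    = (\<Sum>i\<le>m. gr_integral R (z \<otimes> alternant (int (p + m - i)) (int (q + i))))"
proof -
  define e1 where "e1 = \<ominus> chern_sub R 1"
  define e2 where "e2 = chern_sub R 2"
  have cl: "e1 \<in> carrier R" "e2 \<in> carrier R"
    by (simp_all add: e1_def e2_def chern_sub_closed)
  have e1T: "e1 \<otimes> alternant (int p) (int q) = alternant (int (Suc p)) (int q) \<oplus> alternant (int p) (int (Suc q))" for p q
    using chern_mult_alternant(1)[of "int p" "int q"] by (simp add: e1_def add.commute)
  have e2T: "e2 \<otimes> alternant (int p) (int q) = alternant (int (Suc p)) (int (Suc q))" for p q
    using chern_mult_alternant(2)[of "int p" "int q"] by (simp add: e2_def add.commute)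
  have neg: "\<ominus> (\<ominus> a \<otimes> s \<oplus> b \<otimes> t) = a \<otimes> s \<ominus> b \<otimes> t"
    if "a \<in> carrier R" "b \<in> carrier R" "s \<in> carrier R" "t \<in> carrier R" for a b s t
    using that by algebra
  \<comment> \<open>In the Chern roots: h_(m+1) = (x + y) h_m - x y h_(m-1).\<close>
  have rec: "\<sigma> R (int (Suc m)) = e1 \<otimes> \<sigma> R (int m) \<ominus> e2 \<otimes> \<sigma> R (int m - 1)" for m
    using sigma_rec[of "int m"] neg[of e1 e2 "\<sigma> R (int m)" "\<sigma> R (int m - 1)"] cl
    by (simp add: e1_def e2_def chern_sub_closed add.commute)
  show ?thesis
  proof (induction m arbitrary: p q rule: induct_nat_012)
    case 0
    show ?case using z by (simp add: sigma_0)
  next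
    case 1
    have "\<sigma> R (int (Suc 0)) = e1"
      using rec[of 0] cl by (simp add: sigma_0 sigma_neg minus_eq)
    then have "gr_integral R (z \<otimes> (\<sigma> R (int (Suc 0)) \<otimes> alternant (int p) (int q)))
        = gr_integral R (z \<otimes> alternant (int (Suc p)) (int q)) + gr_integral R (z \<otimes> alternant (int p) (int (Suc q)))"
      using z by (simp add: e1T r_distr integral_add del: of_nat_Suc)
    then show ?case by (simp add: add.commute)
  next
    case (ge2 m)
    let ?I = "\<lambda>p q. gr_integral R (z \<otimes> alternant (int p) (int q))"
    have "\<sigma> R (int (Suc (Suc m))) = e1 \<otimes> \<sigma> R (int (Suc m)) \<ominus> e2 \<otimes> \<sigma> R (int m)"
      using rec[of "Suc m"] by simp
    moreover have "z \<otimes> ((e1 \<otimes> s \<ominus> e2 \<otimes> t) \<otimes> x) = z \<otimes> (s \<otimes> (e1 \<otimes> x)) \<ominus> z \<otimes> (t \<otimes> (e2 \<otimes> x))"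
      if "s \<in> carrier R" "t \<in> carrier R" "x \<in> carrier R" for s t x
      using that cl z by algebra
    ultimately have "z \<otimes> (\<sigma> R (int (Suc (Suc m))) \<otimes> alternant (int p) (int q))
      = (z \<otimes> (\<sigma> R (int (Suc m)) \<otimes> alternant (int (Suc p)) (int q)) \<oplus> z \<otimes> (\<sigma> R (int (Suc m)) \<otimes> alternant (int p) (int (Suc q))))
        \<ominus> z \<otimes> (\<sigma> R (int m) \<otimes> alternant (int (Suc p)) (int (Suc q)))"
      using z by (simp add: e1T e2T r_distr del: of_nat_Suc)
    then have "gr_integral R (z \<otimes> (\<sigma> R (int (Suc (Suc m))) \<otimes> alternant (int p) (int q)))
      = (\<Sum>i\<le>Suc m. ?I (Suc p + Suc m - i) (q + i)) + (\<Sum>i\<le>Suc m. ?I (p + Suc m - i) (Suc q + i))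
        - (\<Sum>i\<le>m. ?I (Suc p + m - i) (Suc q + i))"
      using z by (simp only: integral_diff integral_add ge2 m_closed a_closed sigma_closed alternant_closed)
    \<comment> \<open>All terms of this sum but the last cancel against the subtracted sum; the last
      one completes the first sum with the index m + 2.\<close>
    also have "(\<Sum>i\<le>Suc m. ?I (p + Suc m - i) (Suc q + i)) 
       = (\<Sum>i\<le>m. ?I (Suc p + m - i) (Suc q + i)) + ?I p (q + Suc (Suc m))"
      by simp
    also have "(\<Sum>i\<le>Suc m. ?I (Suc p + Suc m - i) (q + i)) = (\<Sum>i\<le>Suc m. ?I (p + Suc (Suc m) - i) (q + i))"
      by simp
    finally show ?case by (simp add: ac_simps)
  qed
qed

text \<open>For q < N - 2 both products contain a sigma of index above N - 2, and at q = N - 2 only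
  the square of the top class survives. Antisymmetry settles larger q.\<close>

lemma integral_alternant:
  assumes N: "N \<ge> 2" and pq: "p + q = 2 * N - 3"
  shows "gr_integral R (alternant (int p) (int q)) = (if q = N - 2 then 1 else if q = N - 1 then - 1 else 0)"
proof -
  have gt: "gr_integral R (alternant (int p) (int q)) = (if q = N - 2 then 1 else 0)"
    if "p + q = 2 * N - 3" "q \<le> N - 2" for p q
  proof (cases "q = N - 2")
    case True
    then have p: "int p - 1 = int N - 2" and q: "int q = int N - 2" and zero: "\<sigma> R (int p) = \<zero>"
      using that N by (auto intro: sigma_large)
    show ?thesis
      unfolding alternant_def p q zero using integral_top_square[OF N] True by (simp add: minus_eq)
  next
    case False
    then have "\<sigma> R (int p) = \<zero>" "\<sigma> R (int p - 1) = \<zero>"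
      using that N by (auto intro!: sigma_large)
    with False show ?thesis
      unfolding alternant_def by (simp add: minus_eq integral_zero)
  qed
  show ?thesis
  proof (cases "q \<le> N - 2")
    case True
    then show ?thesis using gt[OF pq True] N by auto
  next
    case False
    then have "p \<le> N - 2" using pq N by simp
    moreover have "q + p = 2 * N - 3" using pq by simp
    ultimately have "gr_integral R (alternant (int q) (int p)) = (if p = N - 2 then 1 else 0)"
      using gt by blast
    moreover have "p = N - 2 \<longleftrightarrow> q = N - 1" using pq False N by auto
    moreover have "gr_integral R (alternant (int p) (int q)) = - gr_integral R (alternant (int q) (int p))"
      unfolding alternant_swap[of "int p" "int q"] by (simp add: integral_neg)
    ultimately show ?thesis
      using False by (simp only:) simp
  qed
qed

section \<open>Integrals as coefficients of dehomogenized polynomials\<close>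

text \<open>
  Integration against \<^const>\<open>alternant\<close> extracts a coefficient of the dehomogenized polynomial \<open>f\<close>
  of degree \<open>D\<close>.
\<close>

definition represents :: "'a \<Rightarrow> int fps \<Rightarrow> int \<Rightarrow> bool" where
  "represents w f D \<longleftrightarrow> w \<in> carrier R \<and> (\<forall>p q. int p + int q + D = 2 * int N - 3 \<longrightarrow>
     gr_integral R (w \<otimes> alternant (int p) (int q)) = fps_nth ((fps_X - 1) * fps_X ^ q * f) (N - 1))"

text \<open>In (y - 1) y^q = y^(q+1) - y^q the coefficient of y^(N-1) is 1 for q = N - 2 and -1 for
  q = N - 1, as in \<open>integral_alternant\<close>.\<close>

lemma represents_one:
  assumes "N \<ge> 2"
  shows "represents \<one> 1 0"
  unfolding represents_def
proof (intro conjI allI impI)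
  fix p q assume "int p + int q + 0 = 2 * int N - 3"
  then have pq: "p + q = 2 * N - 3" by simp
  have X: "(fps_X - 1) * fps_X ^ q * 1 = (fps_X ^ Suc q - fps_X ^ q :: int fps)"
    by (simp add: algebra_simps)
  have "Suc q = N - 1 \<longleftrightarrow> q = N - 2" and "N - 2 \<noteq> N - 1"
    using assms by auto
  then show "gr_integral R (\<one> \<otimes> alternant (int p) (int q)) = fps_nth ((fps_X - 1) * fps_X ^ q * 1) (N - 1)"
    unfolding X l_one[OF alternant_closed] integral_alternant[OF assms pq] fps_sub_nth fps_X_power_nth by (simp add: eq_commute)
qed simp

text \<open>The Pieri rule replaces q by q + i for i = 0, ..., m, and y^q h_m(1, y) is the sum of
  the y^(q+i). The exponent p is determined by the degree, so setting x = 1 loses nothing.\<close>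

lemma represents_sigma_mult:
  assumes w: "represents w f D"
  shows "represents (\<sigma> R m \<otimes> w) (hsym m * f) (m + D)"
proof (cases "m < 0")
  case True
  then show ?thesis
    using w by (simp add: represents_def sigma_neg hsym_neg integral_zero)
next
  case False
  then obtain n where m: "m = int n" by (metis nonneg_int_cases not_less)
  have wc: "w \<in> carrier R" using w by (simp add: represents_def)
  show ?thesis
    unfolding represents_def m
  proof (intro conjI allI impI)
    show "\<sigma> R (int n) \<otimes> w \<in> carrier R" using wc by simp
  next
    fix p q assume pq: "int p + int q + (int n + D) = 2 * int N - 3"
    have "\<sigma> R (int n) \<otimes> w \<otimes> alternant (int p) (int q) = w \<otimes> (\<sigma> R (int n) \<otimes> alternant (int p) (int q))"
      using wc by (simp add: m_ac)
    then have "gr_integral R (\<sigma> R (int n) \<otimes> w \<otimes> alternant (int p) (int q))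
        = (\<Sum>i\<le>n. gr_integral R (w \<otimes> alternant (int (p + n - i)) (int (q + i))))"
      by (simp only: integral_pieri[OF wc])
    also have "\<dots> = (\<Sum>i\<le>n. fps_nth ((fps_X - 1) * fps_X ^ (q + i) * f) (N - 1))"
    proof (rule sum.cong[OF refl])
      fix i assume "i \<in> {..n}"
      then have "int (p + n - i) + int (q + i) + D = 2 * int N - 3"
        using pq by (simp add: of_nat_diff)
      then show "gr_integral R (w \<otimes> alternant (int (p + n - i)) (int (q + i)))
          = fps_nth ((fps_X - 1) * fps_X ^ (q + i) * f) (N - 1)"
        using w unfolding represents_def by blast
    qed
    also have "\<dots> = fps_nth (\<Sum>i\<le>n. (fps_X - 1) * fps_X ^ (q + i) * f) (N - 1)"
      by (simp add: fps_sum_nth)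
    also have "(\<Sum>i\<le>n. (fps_X - 1) * fps_X ^ (q + i) * f) = (fps_X - 1) * fps_X ^ q * (hsym (int n) * f)"
      by (simp add: hsym_of_nat power_add sum_distrib_left sum_distrib_right ac_simps)
    finally show "gr_integral R (\<sigma> R (int n) \<otimes> w \<otimes> alternant (int p) (int q))
        = fps_nth ((fps_X - 1) * fps_X ^ q * (hsym (int n) * f)) (N - 1)" .
  qed
qed

lemma represents_finprod:
  assumes "finite I" and w: "represents w f D"
  shows "represents ((\<Otimes>h\<in>I. \<sigma> R (a h)) \<otimes> w) ((\<Prod>h\<in>I. hsym (a h)) * f) ((\<Sum>h\<in>I. a h) + D)"
  using assms(1)
proof induction
  case empty
  then show ?case using w by (simp add: represents_def)
next
  case (insert h I)
  have "w \<in> carrier R" using w by (simp add: represents_def)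
  then have "(\<Otimes>h\<in>insert h I. \<sigma> R (a h)) \<otimes> w = \<sigma> R (a h) \<otimes> ((\<Otimes>h\<in>I. \<sigma> R (a h)) \<otimes> w)"
    using insert by (simp add: m_assoc)
  then show ?case
    using represents_sigma_mult[OF insert.IH, of "a h"] insert.hyps by (simp add: ac_simps)
qed

lemma represents_finsum:
  assumes "finite I" and w: "\<And>i. i \<in> I \<Longrightarrow> represents (w i) (f i) D"
  shows "represents (finsum R w I) (\<Sum>i\<in>I. f i) D"
  using assms
proof (induction rule: finite_induct)
  case empty
  show ?case by (simp add: represents_def integral_zero)
next
  case (insert i I)
  have cl: "w \<in> I \<rightarrow> carrier R" "w i \<in> carrier R" "finsum R w I \<in> carrier R"
    using insert by (auto simp: represents_def)
  with insert show ?case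
    by (simp add: represents_def l_distr integral_add distrib_left)
qed

text \<open>\<open>alternant 1 0\<close> is the unit, and for p = 1, q = 0 the degree equation reads
  D = 2 N - 4, the dimension of Gr(2,N).\<close>

lemma integral_represents:
  assumes "represents w f (2 * int N - 4)"
  shows "gr_integral R w = fps_nth ((fps_X - 1) * f) (N - 1)"
proof -
  have "gr_integral R (w \<otimes> alternant (int 1) (int 0)) = fps_nth ((fps_X - 1) * fps_X ^ 0 * f) (N - 1)"
    using assms unfolding represents_def by (elim conjE allE[of _ 1] allE[of _ 0]) simp
  then show ?thesis
    using assms by (simp add: alternant_1_0 represents_def)
qed

end

section \<open>The alternating sum of integrals as a single coefficient\<close>

lemma (in Gr2_intersection_ring) integral_sigma_products:
  assumes N: "N \<ge> 2" and fin: "finite I" "finite J"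
    and deg: "(\<Sum>h\<in>I. a h) + (\<Sum>h\<in>J. b h) + int n = 2 * int N - 4"
  shows "gr_integral R ((\<Otimes>h\<in>I. \<sigma> R (a h)) \<otimes> (\<Otimes>h\<in>J. \<sigma> R (b h)) \<otimes>
       finsum R (\<lambda>(i, j). \<sigma> R (int i) \<otimes> \<sigma> R (int j)) {(i, j). i + j = n})
     = fps_nth ((fps_X - 1) * ((\<Prod>h\<in>I. hsym (a h)) * (\<Prod>h\<in>J. hsym (b h)) *
       (\<Sum>(i, j)\<in>{(i, j). i + j = n}. hsym (int i) * hsym (int j)))) (N - 1)"
proof -
  let ?M = "{(i, j). i + j = n}"
  let ?S = "finsum R (\<lambda>(i, j). \<sigma> R (int i) \<otimes> \<sigma> R (int j)) ?M"
  have "?M \<subseteq> {..n} \<times> {..n}" by auto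
  then have "finite ?M" by (rule finite_subset) simp
  \<comment> \<open>All terms have the same degree i + j = n, as \<open>represents_finsum\<close>
    requires.\<close>
  moreover have "represents (case x of (i, j) \<Rightarrow> \<sigma> R (int i) \<otimes> \<sigma> R (int j))
      (case x of (i, j) \<Rightarrow> hsym (int i) * hsym (int j)) (int n)" if "x \<in> ?M" for x
    using represents_sigma_mult[OF represents_sigma_mult[OF represents_one[OF N], of "int (snd x)"], of "int (fst x)"] that
    by (auto simp flip: of_nat_add)
  ultimately have S: "represents ?S (\<Sum>(i, j)\<in>?M. hsym (int i) * hsym (int j)) (int n)"
    by (rule represents_finsum)
  note rep = represents_finprod[OF fin(1) represents_finprod[OF fin(2) S, of b], of a]
  have "?S \<in> carrier R" using S by (simp add: represents_def)
  then have "(\<Otimes>h\<in>I. \<sigma> R (a h)) \<otimes> (\<Otimes>h\<in>J. \<sigma> R (b h)) \<otimes> ?S = (\<Otimes>h\<in>I. \<sigma> R (a h)) \<otimes> ((\<Otimes>h\<in>J. \<sigma> R (b h)) \<otimes> ?S)"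
    by (intro m_assoc) auto
  moreover have sum: "(\<Sum>h\<in>I. a h) + ((\<Sum>h\<in>J. b h) + int n) = 2 * int N - 4"
    using deg by simp
  ultimately show ?thesis
    using integral_represents[OF rep[unfolded sum]] by (simp only: mult.assoc)
qed

text \<open>Expand over the set I of factors contributing their t-free term; each of the others
  brings - y t. This lowers the index k - 3 by #J, and nothing remains when #J exceeds k -
  3.\<close>

lemma coeff_genfun_expand:
  "fps_nth (genfun k r) (k - 3) = (\<Sum>I\<in>Pow {1..k}. let J = {1..k} - I in
     (- fps_X) ^ card J * ((\<Prod>h\<in>I. hsym (int (r h) - 1)) * (\<Prod>h\<in>J. hsym (int (r h) - 2)) *
       (if k - 3 < card J then 0 else \<Sum>(i, j)\<in>{(i, j). i + j = k - 3 - card J}. hsym (int i) * hsym (int j))))"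
proof -
  let ?W = "(fps_geom 1 * fps_geom fps_X) ^ 2 :: int fps fps"
  let ?a = "\<lambda>h. hsym (int (r h) - 1)" and ?b = "\<lambda>h. hsym (int (r h) - 2)"
  have const: "(\<Prod>h\<in>S. fps_const (f h)) = (fps_const (\<Prod>h\<in>S. f h) :: int fps fps)" for f and S :: "nat set"
    by (induction S rule: infinite_finite_induct) simp_all
  have "genfun k r = (\<Sum>I\<in>Pow {1..k}. (\<Prod>h\<in>I. fps_const (?a h)) * (\<Prod>h\<in>{1..k} - I. fps_const (- fps_X * ?b h) * fps_X) * ?W)"
    by (subst prod_add) (simp_all add: sum_distrib_right)
  also have "fps_nth \<dots> (k - 3) = (\<Sum>I\<in>Pow {1..k}. let J = {1..k} - I in
     (- fps_X) ^ card J * ((\<Prod>h\<in>I. ?a h) * (\<Prod>h\<in>J. ?b h) * (if k - 3 < card J then 0 else fps_nth ?W (k - 3 - card J))))"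
    unfolding fps_sum_nth Let_def
  proof (rule sum.cong[OF refl])
    fix I
    let ?J = "{1..k} - I"
    have 1: "(\<Prod>h\<in>?J. fps_const (- fps_X * ?b h) * fps_X)
        = fps_const ((- fps_X) ^ card ?J * (\<Prod>h\<in>?J. ?b h)) * (fps_X ^ card ?J :: int fps fps)"
      by (simp only: prod.distrib const prod_constant)
    have 2: "fps_const a * (fps_const b * x) * ?W = fps_const (a * b) * (x * ?W)" for a b x
      by (simp only: fps_const_mult[symmetric] mult.assoc)
    show "fps_nth ((\<Prod>h\<in>I. fps_const (?a h)) * (\<Prod>h\<in>?J. fps_const (- fps_X * ?b h) * fps_X) * ?W) (k - 3)
        = (- fps_X) ^ card ?J * ((\<Prod>h\<in>I. ?a h) * (\<Prod>h\<in>?J. ?b h) * (if k - 3 < card ?J then 0 else fps_nth ?W (k - 3 - card ?J)))"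
      unfolding 1 const 2 fps_mult_left_const_nth fps_X_power_mult_nth by (simp only: ac_simps)
  qed
  finally show ?thesis unfolding fps_nth_geom_mult_geom_square .
qed

theorem proposition29:
  fixes l d k :: nat and r :: "nat \<Rightarrow> nat"
    and A :: "nat \<Rightarrow> 'a intersection_ring"
  assumes "\<And>N. N \<ge> 2 \<Longrightarrow> Gr2_intersection_ring N (A N)"
    and "\<And>h. h \<in> {1..k} \<Longrightarrow> r h > 0"
    and "3 + 2 * l = (\<Sum>h=1..k. r h)"
    and "\<And>h. h \<in> {1..k} \<Longrightarrow> r h \<le> l + 1"
    and "k \<ge> 3"
    and "d = l + 1"
  shows "(\<Sum>(I, J) \<in> {(I, J). I \<union> J = {1..k} \<and> I \<inter> J = {}}.
      (-1) ^ card J *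
      (if card J < d \<and> card J + 3 \<le> k
       then let R = A (d + 1 - card J) in
         gr_integral R
           ((\<Otimes>\<^bsub>R\<^esub>h\<in>I. \<sigma> R (int (r h) - 1)) \<otimes>\<^bsub>R\<^esub> (\<Otimes>\<^bsub>R\<^esub>h\<in>J. \<sigma> R (int (r h) - 2)) \<otimes>\<^bsub>R\<^esub>
            finsum R (\<lambda>(i, j). \<sigma> R (int i) \<otimes>\<^bsub>R\<^esub> \<sigma> R (int j)) {(i, j). i + j = k - 3 - card J})
       else 0)) = (1 :: int)"
proof -
  let ?a = "\<lambda>h. int (r h) - 1" and ?b = "\<lambda>h. int (r h) - 2"
  define G where "G n = (\<Sum>(i, j)\<in>{(i, j). i + j = n}. hsym (int i) * hsym (int j))" for n
  define F where "F I J = (\<Prod>h\<in>I. hsym (?a h)) * (\<Prod>h\<in>J. hsym (?b h)) *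
       (if k - 3 < card J then 0 else G (k - 3 - card J))" for I J
  \<comment> \<open>Every summand, including those that are 0 by convention, is the coefficient of
    y^d in the same expression. The factor y^(#J) absorbs the change of Grassmannian, since N - 1 =
    d - #J for N = d + 1 - #J.\<close>
  have summand: "(-1) ^ card J *
      (if card J < d \<and> card J + 3 \<le> k
       then let R = A (d + 1 - card J) in
         gr_integral R
           ((\<Otimes>\<^bsub>R\<^esub>h\<in>I. \<sigma> R (?a h)) \<otimes>\<^bsub>R\<^esub> (\<Otimes>\<^bsub>R\<^esub>h\<in>J. \<sigma> R (?b h)) \<otimes>\<^bsub>R\<^esub>
            finsum R (\<lambda>(i, j). \<sigma> R (int i) \<otimes>\<^bsub>R\<^esub> \<sigma> R (int j)) {(i, j). i + j = k - 3 - card J})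
       else 0) = fps_nth ((fps_X - 1) * ((- fps_X) ^ card J * F I J)) d" (is "?lhs = ?rhs")
    if IJ: "I \<union> J = {1..k}" "I \<inter> J = {}" for I J
  proof -
    have fin: "finite I" "finite J"
      using IJ(1) by (metis finite_Un finite_atLeastAtMost)+
    have card: "card I + card J = k"
      using IJ fin card_Un_disjoint[of I J] by simp
    have total: "(\<Sum>h\<in>I. r h) + (\<Sum>h\<in>J. r h) = 3 + 2 * l"
      using IJ fin assms(3) sum.union_disjoint[of I J r] by simp
    have pos: "r h > 0" if "h \<in> I \<union> J" for h
      using assms(2) that IJ by blast
    have sign: "((- fps_X) ^ n :: int fps) = (-1) ^ n * fps_X ^ n" for n
      by (rule power_minus)
    have "?rhs = fps_nth (fps_X ^ card J * ((-1) ^ card J * ((fps_X - 1) * F I J))) d"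
      unfolding sign by (simp only: ac_simps)
    also have "((-1) ^ card J :: int fps) = fps_const ((-1) ^ card J)"
      by (simp flip: fps_const_power fps_const_neg)
    finally have rhs: "?rhs = (if d < card J then 0 else (-1) ^ card J * fps_nth ((fps_X - 1) * F I J) (d - card J))"
      by (simp only: fps_X_power_mult_nth fps_mult_left_const_nth)
    show ?thesis
    proof (cases "card J < d \<and> card J + 3 \<le> k")
      case True
      let ?N = "d + 1 - card J"
      interpret Gr2_intersection_ring ?N "A ?N"
        using True by (intro assms(1)) linarith
      \<comment> \<open>The degree is 3 + 2 l - k - #J + (k - 3 - #J) = 2 (d - 1 - #J), the
        dimension of Gr(2, d + 1 - #J).\<close>
      have "(\<Sum>h\<in>I. ?a h) + (\<Sum>h\<in>J. ?b h) + int (k - 3 - card J)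
          = int ((\<Sum>h\<in>I. r h) + (\<Sum>h\<in>J. r h)) - int (card I + card J) - int (card J) + int (k - 3 - card J)"
        by (simp add: sum_subtractf)
      also have "\<dots> = 2 * int ?N - 4"
        unfolding total card using True assms(6) by (simp add: of_nat_diff)
      finally have int: "gr_integral (A ?N) ((\<Otimes>\<^bsub>A ?N\<^esub>h\<in>I. \<sigma> (A ?N) (?a h)) \<otimes>\<^bsub>A ?N\<^esub> (\<Otimes>\<^bsub>A ?N\<^esub>h\<in>J. \<sigma> (A ?N) (?b h)) \<otimes>\<^bsub>A ?N\<^esub>
          finsum (A ?N) (\<lambda>(i, j). \<sigma> (A ?N) (int i) \<otimes>\<^bsub>A ?N\<^esub> \<sigma> (A ?N) (int j)) {(i, j). i + j = k - 3 - card J})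
        = fps_nth ((fps_X - 1) * ((\<Prod>h\<in>I. hsym (?a h)) * (\<Prod>h\<in>J. hsym (?b h)) * G (k - 3 - card J))) (?N - 1)"
        unfolding G_def using True by (intro integral_sigma_products fin) auto
      have "\<not> k - 3 < card J" "\<not> d < card J" and N1: "?N - 1 = d - card J"
        using True by auto
      then show ?thesis
        unfolding rhs unfolding F_def Let_def int N1 using True by (simp only: if_True if_False simp_thms)
    next
      case False
      \<comment> \<open>The conventional zeros must agree with the coefficients. If #J > d the power
        of y is too high; otherwise \<open>F I J\<close> vanishes, through a factor
        \<open>hsym (-1)\<close> or because #J > k - 3.\<close>
      have "F I J = 0" if J: "\<not> d < card J"
      proof (cases "\<exists>h\<in>J. r h = 1")
        case True
        then obtain h where h: "h \<in> J" "r h = 1" by blast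
        then have "hsym (?b h) = 0" by (simp add: hsym_neg)
        then have "(\<Prod>h\<in>J. hsym (?b h)) = 0"
          using fin(2) h(1) by (intro prod_zero bexI)
        then show ?thesis by (simp add: F_def)
      next
        case no1: False
        \<comment> \<open>Each h in I contributes at least 1 and each h in J at least 2 to 3 + 2 l,
          so k + #J is at most 3 + 2 l. In the critical case #J = d this gives k \<le> l + 2 and
          hence k - 3 < #J.\<close>
        have "card I * 1 \<le> (\<Sum>h\<in>I. r h)"
          using sum_bounded_below[of I 1 r] pos by (simp add: Suc_le_eq)
        moreover have "2 \<le> r h" if "h \<in> J" for h
          using pos[of h] no1 that by (cases "r h = 1") auto
        then have "card J * 2 \<le> (\<Sum>h\<in>J. r h)"
          using sum_bounded_below[of J 2 r] by simp
        ultimately have "k + card J \<le> 3 + 2 * l"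
          using total card by linarith
        then have "k - 3 < card J" using False J assms(5,6) by linarith
        then show ?thesis by (simp add: F_def)
      qed
      then show ?thesis unfolding rhs using False by auto
    qed
  qed
  have "?thesis \<longleftrightarrow> (\<Sum>(I, J) \<in> {(I, J). I \<union> J = {1..k} \<and> I \<inter> J = {}}.
      fps_nth ((fps_X - 1) * ((- fps_X) ^ card J * F I J)) d) = 1"
    using summand by (intro arg_cong[of _ _ "\<lambda>x. x = 1"] sum.cong) auto
  also have "(\<Sum>(I, J) \<in> {(I, J). I \<union> J = {1..k} \<and> I \<inter> J = {}}.
      fps_nth ((fps_X - 1) * ((- fps_X) ^ card J * F I J)) d)
    = (\<Sum>I\<in>Pow {1..k}. fps_nth ((fps_X - 1) * ((- fps_X) ^ card ({1..k} - I) * F I ({1..k} - I))) d)"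
  proof -
    have "{(I, J). I \<union> J = {1..k} \<and> I \<inter> J = {}} = (\<lambda>I. (I, {1..k} - I)) ` Pow {1..k}"
      by auto
    then show ?thesis
      by (simp only:) (subst sum.reindex, simp_all add: inj_on_def)
  qed
  also have "\<dots> = fps_nth ((fps_X - 1) * fps_nth (genfun k r) (k - 3)) d"
    unfolding coeff_genfun_expand Let_def F_def G_def sum_distrib_left fps_sum_nth ..
  also have "\<dots> = 1"
    unfolding assms(6) by (rule coeff_genfun_eq_1) (use assms in auto)
  finally show ?thesis by simp
qed

end
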